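(* Let $\Sigma$ be a positive definite $2\times 2$ matrix, and let $f(x_1,x_2)=ax_1^2+2bx_1x_2+cx_2^2$ be a nonzero real quadratic form with matrix $$A=\begin{pmatrix} a&b\\ b&c\end{pmatrix}\neq 0.$$ (a) If $b^2-ac\ge 0$, then $W_{f,\Sigma}\sim\frac14\chi^2_1$. (b) If $b^2-ac<0$, then $W_{f,\Sigma}$ has the same distribution as $$\frac14\left(Z_1^2+\frac{4\det(A\Sigma)}{\operatorname{tr}(A\Sigma)^2}\,Z_2^2\right),$$ where $Z_1$ and $Z_2$ are independent standard normal random variables.
   Context: For a homogeneous polynomial $f\in\mathbb{R}[x_1,\dots,x_k]$ with gradient $\nabla f$ and a positive semidefinite $k\times k$ matrix $\Sigma$, define $$W_{f,\Sigma}=\frac{f(X)^2}{(\nabla f(X))^T\,\Sigma\,\nabla f(X)},\qquad X\sim\mathcal{N}_k(0,\Sigma).$$ Here $k=2$. $\chi^2_1$ denotes the chi-square distribution with one degree of freedom, and $W\sim \frac14\chi^2_1$ means $4W\sim\chi^2_1$. *)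

theory Defs
  imports "HOL-Probability.Probability"
begin

text \<open>Symmetry is part of positive definiteness, as for covariance matrices.\<close>

definition pos_definite :: "real^'k^'k \<Rightarrow> bool" where
  "pos_definite S \<longleftrightarrow> transpose S = S \<and> (\<forall>x. x \<noteq> 0 \<longrightarrow> x \<bullet> (S *v x) > 0)"

definition gradient :: "('a::real_inner \<Rightarrow> real) \<Rightarrow> 'a \<Rightarrow> 'a" where
  "gradient f x = (THE D. GDERIV f x :> D)"

lemma gradient_eqI:
  assumes "GDERIV f x :> D"
  shows "gradient f x = D"
  unfolding gradient_def
proof (rule the_equality)
  show "GDERIV f x :> D" by (fact assms)
next
  fix D' assume "GDERIV f x :> D'"
  with assms have "(\<lambda>h. h \<bullet> D') = (\<lambda>h. h \<bullet> D)"
    unfolding gderiv_def by (blast intro: has_derivative_unique)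
  then have "h \<bullet> D' = h \<bullet> D" for h
    by meson
  then show "D' = D"
    by (metis vector_eq_ldot inner_commute)
qed

definition std_gaussian :: "(real^'k) measure" where
  "std_gaussian = density lborel (\<lambda>x. ennreal (\<Prod>i\<in>UNIV. std_normal_density (x $ i)))"

text \<open>
  \<open>centered_gaussian M X S\<close> says that the random vector \<open>X\<close> on \<open>M\<close> has law \<open>N(0, S)\<close>, the law of
  \<open>B Z\<close> where \<open>Z\<close> is a standard Gaussian vector and \<open>S = B B\<^sup>T\<close>. The law does not depend on
  the choice of \<open>B\<close>, which exists for every positive semidefinite \<open>S\<close>, singular or not.
\<close>

definition centered_gaussian :: "'m measure \<Rightarrow> ('m \<Rightarrow> real^'k) \<Rightarrow> real^'k^'k \<Rightarrow> bool" where
  "centered_gaussian M X S \<longleftrightarrow>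
     X \<in> borel_measurable M \<and>
     (\<exists>B :: real^'k^'k. B ** transpose B = S \<and>
        distr M borel X = distr std_gaussian borel (\<lambda>z. B *v z))"

text \<open>The law of the sum of the squares of \<open>n\<close> independent standard normal variables.\<close>

definition chi_square :: "nat \<Rightarrow> real measure" where
  "chi_square n =
     distr (PiM {..<n} (\<lambda>_. density lborel std_normal_density)) borel (\<lambda>z. \<Sum>i<n. (z i)\<^sup>2)"

text \<open>
  The value is \<open>0\<close> where the denominator vanishes. For a quadratic form \<open>f \<noteq> 0\<close> and
  positive definite \<open>S\<close> this is the kernel of the matrix of \<open>f\<close>, a null set for \<open>N(0, S)\<close>.
\<close>

definition W :: "(real^'k \<Rightarrow> real) \<Rightarrow> real^'k^'k \<Rightarrow> real^'k \<Rightarrow> real" where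
  "W f S x = (f x)\<^sup>2 / (gradient f x \<bullet> (S *v gradient f x))"

end

theory Submission
  imports Defs
begin

text \<open>
  Write \<open>X = B Z\<close> with \<open>S = B B\<^sup>T\<close> and \<open>Z\<close> standard Gaussian. With \<open>C = B\<^sup>T A B\<close> one gets
  \<open>4 W = (Z\<^sup>T C Z)\<^sup>2 / \<bar>C Z\<bar>\<^sup>2\<close>. A rotation diagonalizes \<open>C\<close> and preserves the law of \<open>Z\<close>, so \<open>4 W\<close>
  has the law of \<open>(l x\<^sup>2 + m y\<^sup>2)\<^sup>2 / (l\<^sup>2 x\<^sup>2 + m\<^sup>2 y\<^sup>2)\<close> for independent standard normal \<open>x\<close>, \<open>y\<close>,
  where \<open>l m = det C = det (A S)\<close> and \<open>l + m = tr C = tr (A S)\<close> (\<open>distr_W_diagonal\<close>).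

  The heart of the argument is \<open>distr_gauss_pair_Boole\<close>: for \<open>k \<ge> 0\<close> the pair
  \<open>(s, t) = ((x\<^sup>2 - k y\<^sup>2)\<^sup>2 / (x\<^sup>2 + k\<^sup>2 y\<^sup>2), ((1 + k) x y)\<^sup>2 / (x\<^sup>2 + k\<^sup>2 y\<^sup>2))\<close> has the same law as
  \<open>(x\<^sup>2, y\<^sup>2)\<close>. Indeed \<open>s + t = x\<^sup>2 + y\<^sup>2\<close>, which is independent of the ratio \<open>x / y\<close>, and
  \<open>s / t = p\<^sup>2\<close> with \<open>p = (x / y - k y / x) / (1 + k)\<close>. The ratio \<open>x / y\<close> is Cauchy
  distributed, and the Boole transformation \<open>w \<mapsto> (w - k / w) / (1 + k)\<close> preserves the Cauchy law
  (\<open>distr_cauchy_Boole\<close>).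

  If \<open>l m \<le> 0\<close>, take \<open>k = - m / l\<close>: then \<open>4 W\<close> is \<open>s\<close>, which is distributed like \<open>x\<^sup>2\<close>. If
  \<open>l m > 0\<close>, take \<open>k = m / l\<close>: then \<open>(x\<^sup>2 + k y\<^sup>2)\<^sup>2 = (x\<^sup>2 - k y\<^sup>2)\<^sup>2 + 4 k x\<^sup>2 y\<^sup>2\<close> shows that \<open>4 W\<close>
  is \<open>s + 4 k / (1 + k)\<^sup>2 t\<close>, where \<open>4 k / (1 + k)\<^sup>2 = 4 l m / (l + m)\<^sup>2\<close>.
\<close>

section \<open>The Cauchy law and the Boole transformation\<close>

text \<open>
  The law of a standard normal variable.
\<close>

definition gauss :: "real measure" where
  "gauss = density lborel std_normal_density"

text \<open>
  The Cauchy law without its normalizing constant: the total mass is \<open>pi\<close>. The factor \<open>1 / pi\<close>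
  is put into the radial measure below.
\<close>

definition cauchy :: "real measure" where
  "cauchy = density lborel (\<lambda>y. ennreal (inverse (1 + y\<^sup>2)))"

lemma sets_gauss [simp, measurable_cong]: "sets gauss = sets borel"
  by (simp add: gauss_def)

lemma sets_cauchy [simp, measurable_cong]: "sets cauchy = sets borel"
  by (simp add: cauchy_def)

lemma space_cauchy [simp]: "space cauchy = UNIV"
  by (simp add: cauchy_def)

lemma prob_space_gauss: "prob_space gauss"
  unfolding gauss_def by (rule prob_space_normal_density) simp

lemma emeasure_cauchy_atMost: "emeasure cauchy {..x} = ennreal (arctan x + pi / 2)"
proof -
  have "emeasure cauchy {..x} = (\<integral>\<^sup>+y. ennreal (inverse (1 + y\<^sup>2)) * indicator {..x} y \<partial>lborel)"
    by (simp add: cauchy_def emeasure_density)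
  also have "\<dots> = (\<integral>\<^sup>+y. ennreal (inverse (1 + y\<^sup>2)) * indicator {- x..} y \<partial>lborel)"
    by (subst nn_integral_real_affine[where c="-1" and t=0])
       (auto intro!: nn_integral_cong split: split_indicator)
  also have "\<dots> = ennreal (pi / 2 - arctan (- x))"
  proof (rule nn_integral_FTC_atLeast)
    show "(arctan has_real_derivative inverse (1 + y\<^sup>2)) (at y)" for y
      by (rule DERIV_arctan)
    show "0 \<le> inverse (1 + y\<^sup>2)" for y :: real
      by (simp add: add_nonneg_nonneg)
  qed (simp_all add: tendsto_arctan_at_top)
  finally show ?thesis by (simp add: arctan_minus add.commute)
qed

lemma finite_measure_cauchy: "finite_measure cauchy"
proof
  have *: "emeasure cauchy {..x} \<le> ennreal pi" for x
    using arctan_ubound[of x] by (auto simp: emeasure_cauchy_atMost intro!: ennreal_leI)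
  have "(SUP i::nat. emeasure cauchy {..real i}) = emeasure cauchy (\<Union>i::nat. {..real i})"
    by (intro SUP_emeasure_incseq) (auto simp: incseq_def)
  moreover have "(\<Union>i::nat. {..real i}) = UNIV"
    by (auto intro: real_arch_simple)
  ultimately have "emeasure cauchy (space cauchy) \<le> ennreal pi"
    using * by (metis SUP_least space_cauchy)
  then show "emeasure cauchy (space cauchy) \<noteq> \<infinity>"
    by (auto simp: top_unique)
qed

lemma measure_cauchy_atMost: "measure cauchy {..x} = arctan x + pi / 2"
  using arctan_lbound[of x] by (simp add: measure_def emeasure_cauchy_atMost)

lemma AE_cauchy_nonzero: "AE y in cauchy. y \<noteq> 0"
  unfolding cauchy_def by (subst AE_density) (auto intro: AE_mp[OF AE_lborel_singleton])

lemma arctan_add_neg_pos: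
  assumes "u < 0" "0 < v"
  shows "arctan u + arctan v = arctan ((u + v) / (1 - u * v))"
proof (rule arctan_unique [symmetric])
  have 1: "arctan u < 0" "0 < arctan v" using assms by auto
  show 2: "- (pi / 2) < arctan u + arctan v" "arctan u + arctan v < pi / 2"
    using 1 arctan_lbound[of u] arctan_ubound[of v] by linarith+
  have "cos (arctan u + arctan v) \<noteq> 0"
    using cos_gt_zero_pi[of "arctan u + arctan v"] 2 by simp
  then show "tan (arctan u + arctan v) = (u + v) / (1 - u * v)"
    by (subst tan_add) (auto simp: tan_arctan)
qed

text \<open>
  For \<open>k > 0\<close> and \<open>y \<noteq> 0\<close>, the inequality \<open>(y - k / y) / (1 + k) \<le> x\<close> means \<open>y \<le> u\<close> or
  \<open>0 < y \<le> v\<close>, where \<open>u < 0 < v\<close> are the roots of \<open>y\<^sup>2 - (1 + k) x y - k\<close>. As \<open>u + v = (1 + k) x\<close> and \<open>u v = - k\<close>, the addition theorem gives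
  \<open>arctan u + arctan v = arctan x\<close>, so the distribution functions agree.
\<close>

lemma distr_cauchy_Boole:
  fixes k :: real
  assumes "0 \<le> k"
  shows "distr cauchy borel (\<lambda>y. (y - k / y) / (1 + k)) = cauchy" (is "distr _ _ ?p = _")
proof (rule cdf_unique')
  interpret finite_measure cauchy by (rule finite_measure_cauchy)
  show "finite_borel_measure cauchy" by standard simp
  show "finite_borel_measure (distr cauchy borel ?p)"
    by (intro finite_borel_measure.intro finite_measure_distr finite_borel_measure_axioms.intro) simp_all
  show "cdf (distr cauchy borel ?p) = cdf cauchy"
  proof
    fix x :: real
    define D where "D = sqrt (((1 + k) * x)\<^sup>2 + 4 * k)"
    define u where "u = ((1 + k) * x - D) / 2"
    define v where "v = ((1 + k) * x + D) / 2"
    have D2: "D\<^sup>2 = ((1 + k) * x)\<^sup>2 + 4 * k" using assms by (simp add: D_def)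
    have sum: "u + v = (1 + k) * x" by (simp add: u_def v_def field_simps)
    have prod: "u * v = - k"
      using D2 by (simp add: u_def v_def field_simps power2_eq_square)
    have meas: "measure (distr cauchy borel ?p) {..x} = measure cauchy {y. ?p y \<le> x}"
      by (subst measure_distr) (auto simp: vimage_def)
    show "cdf (distr cauchy borel ?p) x = cdf cauchy x"
    \<comment> \<open>For \<open>k = 0\<close> one root is zero, but then the map is the identity.\<close>
    proof (cases "k = 0")
      case True
      then show ?thesis unfolding cdf_def meas by (simp add: atMost_def)
    next
      case False
      with assms have k: "0 < k" by simp
      then have "D > \<bar>(1 + k) * x\<bar>"
        unfolding D_def using real_sqrt_less_mono[of "((1 + k) * x)\<^sup>2" "((1 + k) * x)\<^sup>2 + 4 * k"]
        by simp
      then have uv: "u < 0" "0 < v" by (auto simp: u_def v_def)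
      have *: "?p y \<le> x \<longleftrightarrow> y \<le> u \<or> (0 < y \<and> y \<le> v)" if "y \<noteq> 0" for y
      proof -
        have "?p y \<le> x \<longleftrightarrow> y + u * v / y \<le> u + v"
          using k by (simp add: sum prod pos_divide_le_eq mult.commute)
        also have "\<dots> \<longleftrightarrow> (y - u) * (y - v) / y \<le> 0"
        proof -
          have "y + u * v / y - (u + v) = (y - u) * (y - v) / y"
            using that by (simp add: field_simps)
          then show ?thesis by linarith
        qed
        also have "\<dots> \<longleftrightarrow> y \<le> u \<or> (0 < y \<and> y \<le> v)"
        proof (cases "0 < y")
          case True
          with uv have "0 < y - u" by simp
          with uv True show ?thesis by (simp add: divide_le_0_iff mult_le_0_iff)
        next
          case False
          with uv that have "y - v < 0" "y < 0" by simp_all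
          with uv show ?thesis by (simp add: divide_le_0_iff zero_le_mult_iff)
        qed
        finally show ?thesis .
      qed
      have "measure cauchy {y. ?p y \<le> x} = measure cauchy ({..u} \<union> ({..v} - {..0}))"
      proof (rule measure_eq_AE)
        show "AE y in cauchy. (y \<in> {y. ?p y \<le> x}) = (y \<in> {..u} \<union> ({..v} - {..0}))"
          using AE_cauchy_nonzero
        proof eventually_elim
          case (elim y)
          then show ?case using *[of y] by auto
        qed
      qed auto
      also have "\<dots> = measure cauchy {..u} + (measure cauchy {..v} - measure cauchy {..0})"
        using uv by (subst finite_measure_Union) (auto simp: finite_measure_Diff)
      also have "\<dots> = arctan u + arctan v + pi / 2"
        by (simp add: measure_cauchy_atMost)
      also have "arctan u + arctan v = arctan x"
        using k by (simp add: arctan_add_neg_pos[OF uv] sum prod)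
      finally show ?thesis by (simp add: cdf_def meas measure_cauchy_atMost)
    qed
  qed
qed

section \<open>Ratio coordinates for a pair of independent normal variables\<close>

text \<open>
  The law of a signed radius, up to the factor \<open>1 / pi\<close> that normalizes the Cauchy law.
\<close>

definition radial :: "real measure" where
  "radial = density lborel (\<lambda>r. ennreal (\<bar>r\<bar> * exp (- r\<^sup>2 / 2) / (2 * pi)))"

text \<open>
  The point with signed radius \<open>r\<close> and coordinate ratio \<open>y\<close>. The sign of \<open>r\<close> is that of the
  second coordinate, so that the ratio may run over the whole line.
\<close>

definition polar :: "real \<times> real \<Rightarrow> real \<times> real" where
  "polar = (\<lambda>(r, y). (r * y / sqrt (1 + y\<^sup>2), r / sqrt (1 + y\<^sup>2)))"

lemma sets_radial [simp, measurable_cong]: "sets radial = sets borel"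
  by (simp add: radial_def)

lemma measurable_polar [measurable]: "polar \<in> borel \<Otimes>\<^sub>M borel \<rightarrow>\<^sub>M borel \<Otimes>\<^sub>M borel"
  unfolding polar_def by measurable

lemma std_normal_density_pair:
  "std_normal_density x * std_normal_density y = exp (- (x\<^sup>2 + y\<^sup>2) / 2) / (2 * pi)"
proof -
  have "exp (- (x\<^sup>2 + y\<^sup>2) / 2) = exp (- x\<^sup>2 / 2) * exp (- y\<^sup>2 / 2)"
    by (simp add: exp_add [symmetric] diff_divide_distrib)
  then show ?thesis by (simp add: std_normal_density_def)
qed

lemma gauss_pair_density:
  "gauss \<Otimes>\<^sub>M gauss = density (lborel \<Otimes>\<^sub>M lborel)
     (\<lambda>(x, y). ennreal (exp (- (x\<^sup>2 + y\<^sup>2) / 2) / (2 * pi)))"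
proof -
  have "sigma_finite_measure gauss"
    using prob_space_gauss by (simp add: prob_space_imp_sigma_finite)
  then have "gauss \<Otimes>\<^sub>M gauss = density (lborel \<Otimes>\<^sub>M lborel)
      (\<lambda>(x, y). ennreal (std_normal_density x) * ennreal (std_normal_density y))"
    unfolding gauss_def by (intro pair_measure_density) (auto intro: sigma_finite_lborel)
  also have "(\<lambda>(x, y). ennreal (std_normal_density x) * ennreal (std_normal_density y)) =
      (\<lambda>(x, y). ennreal (exp (- (x\<^sup>2 + y\<^sup>2) / 2) / (2 * pi)))"
    by (simp add: fun_eq_iff ennreal_mult [symmetric] std_normal_density_pair)
  finally show ?thesis .
qed

text \<open>
  Substitute \<open>x = s y\<close> in the inner integral, then \<open>s = r / sqrt (1 + y\<^sup>2)\<close>, for which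
  \<open>(s y)\<^sup>2 + s\<^sup>2 = r\<^sup>2\<close>.
\<close>

lemma distr_polar: "distr (radial \<Otimes>\<^sub>M cauchy) (borel \<Otimes>\<^sub>M borel) polar = gauss \<Otimes>\<^sub>M gauss"
proof (rule measure_eqI)
  fix E assume "E \<in> sets (distr (radial \<Otimes>\<^sub>M cauchy) (borel \<Otimes>\<^sub>M borel) polar)"
  then have E [measurable]: "E \<in> sets (borel \<Otimes>\<^sub>M borel)" by simp
  define h :: "real \<times> real \<Rightarrow> ennreal" where "h = indicator E"
  have h [measurable]: "h \<in> borel_measurable (borel \<Otimes>\<^sub>M borel)" unfolding h_def by simp
  define w :: "real \<Rightarrow> real" where "w q = exp (- q / 2) / (2 * pi)" for q
  have w [measurable]: "w \<in> borel_measurable borel" unfolding w_def by measurable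
  have w0: "0 \<le> w q" for q by (simp add: w_def)
  interpret C: finite_measure cauchy by (rule finite_measure_cauchy)
  have rc: "radial \<Otimes>\<^sub>M cauchy = density (lborel \<Otimes>\<^sub>M lborel)
      (\<lambda>(r, y). ennreal (\<bar>r\<bar> * w (r\<^sup>2)) * ennreal (inverse (1 + y\<^sup>2)))"
    unfolding radial_def cauchy_def w_def
    using C.sigma_finite_measure_axioms unfolding cauchy_def
    by (subst pair_measure_density) (auto intro: sigma_finite_lborel simp: mult_ac)
  have "emeasure (gauss \<Otimes>\<^sub>M gauss) E =
      (\<integral>\<^sup>+z. ennreal (w ((fst z)\<^sup>2 + (snd z)\<^sup>2)) * h z \<partial>(lborel \<Otimes>\<^sub>M lborel))"
    unfolding gauss_pair_density by (simp add: emeasure_density h_def w_def case_prod_beta)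
  also have "\<dots> = (\<integral>\<^sup>+s. \<integral>\<^sup>+x. ennreal (w (x\<^sup>2 + s\<^sup>2)) * h (x, s) \<partial>lborel \<partial>lborel)"
    by (subst lborel_pair.nn_integral_snd [symmetric]) (auto simp: split_beta')
  also have "\<dots> = (\<integral>\<^sup>+s. \<integral>\<^sup>+y. ennreal \<bar>s\<bar> * (ennreal (w ((s * y)\<^sup>2 + s\<^sup>2)) * h (s * y, s)) \<partial>lborel \<partial>lborel)"
  proof (rule nn_integral_cong_AE, use AE_lborel_singleton[of 0] in eventually_elim)
    fix s :: real assume "s \<noteq> 0"
    then show "(\<integral>\<^sup>+x. ennreal (w (x\<^sup>2 + s\<^sup>2)) * h (x, s) \<partial>lborel) =
      (\<integral>\<^sup>+y. ennreal \<bar>s\<bar> * (ennreal (w ((s * y)\<^sup>2 + s\<^sup>2)) * h (s * y, s)) \<partial>lborel)"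
      by (subst nn_integral_real_affine[where c=s and t=0]) (simp_all add: nn_integral_cmult)
  qed
  also have "\<dots> = (\<integral>\<^sup>+y. \<integral>\<^sup>+s. ennreal \<bar>s\<bar> * (ennreal (w ((s * y)\<^sup>2 + s\<^sup>2)) * h (s * y, s)) \<partial>lborel \<partial>lborel)"
    by (rule lborel_pair.Fubini') measurable
  also have "\<dots> = (\<integral>\<^sup>+y. \<integral>\<^sup>+r. ennreal (\<bar>r\<bar> * w (r\<^sup>2)) * ennreal (inverse (1 + y\<^sup>2)) * h (polar (r, y)) \<partial>lborel \<partial>lborel)"
  proof (rule nn_integral_cong)
    fix y :: real
    define n where "n = sqrt (1 + y\<^sup>2)"
    have n: "0 < n" "n\<^sup>2 = 1 + y\<^sup>2" by (simp_all add: n_def add_pos_nonneg)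
    have arg: "(r / n * y)\<^sup>2 + (r / n)\<^sup>2 = r\<^sup>2" for r
    proof -
      have "(r / n * y)\<^sup>2 + (r / n)\<^sup>2 = r\<^sup>2 * (1 + y\<^sup>2) / n\<^sup>2"
        by (simp add: power_mult_distrib power_divide algebra_simps add_divide_distrib)
      also have "\<dots> = r\<^sup>2" using n by (metis nonzero_mult_div_cancel_right less_irrefl power_not_zero)
      finally show ?thesis .
    qed
    have "(\<integral>\<^sup>+s. ennreal \<bar>s\<bar> * (ennreal (w ((s * y)\<^sup>2 + s\<^sup>2)) * h (s * y, s)) \<partial>lborel) =
        ennreal (1 / n) * (\<integral>\<^sup>+r. ennreal \<bar>r / n\<bar> * (ennreal (w ((r / n * y)\<^sup>2 + (r / n)\<^sup>2)) * h (r / n * y, r / n)) \<partial>lborel)"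
      using n by (subst nn_integral_real_affine[where c="1/n" and t=0]) simp_all
    also have "\<dots> = (\<integral>\<^sup>+r. ennreal (1 / n) * (ennreal \<bar>r / n\<bar> * (ennreal (w ((r / n * y)\<^sup>2 + (r / n)\<^sup>2)) * h (r / n * y, r / n))) \<partial>lborel)"
      by (rule nn_integral_cmult [symmetric]) measurable
    also have "\<dots> = (\<integral>\<^sup>+r. ennreal (\<bar>r\<bar> * w (r\<^sup>2)) * ennreal (inverse (1 + y\<^sup>2)) * h (polar (r, y)) \<partial>lborel)"
    proof (rule nn_integral_cong)
      fix r :: real
      have "ennreal (1 / n) * (ennreal \<bar>r / n\<bar> * ennreal (w (r\<^sup>2))) = ennreal (1 / n * (\<bar>r / n\<bar> * w (r\<^sup>2)))"
      proof -
        have "0 \<le> 1 / n" "0 \<le> \<bar>r / n\<bar>" using n by simp_all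
        then show ?thesis by (simp only: ennreal_mult w0 mult_nonneg_nonneg)
      qed
      also have "1 / n * (\<bar>r / n\<bar> * w (r\<^sup>2)) = \<bar>r\<bar> * w (r\<^sup>2) * inverse (1 + y\<^sup>2)"
        unfolding n(2)[symmetric] using n(1) by (simp add: power2_eq_square field_simps)
      also have "ennreal \<dots> = ennreal (\<bar>r\<bar> * w (r\<^sup>2)) * ennreal (inverse (1 + y\<^sup>2))"
        using w0 by (intro ennreal_mult) (auto intro: add_nonneg_nonneg)
      finally show "ennreal (1 / n) * (ennreal \<bar>r / n\<bar> * (ennreal (w ((r / n * y)\<^sup>2 + (r / n)\<^sup>2)) * h (r / n * y, r / n))) =
          ennreal (\<bar>r\<bar> * w (r\<^sup>2)) * ennreal (inverse (1 + y\<^sup>2)) * h (polar (r, y))"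
        unfolding arg by (simp add: polar_def n_def mult.assoc [symmetric])
    qed
    finally show "(\<integral>\<^sup>+s. ennreal \<bar>s\<bar> * (ennreal (w ((s * y)\<^sup>2 + s\<^sup>2)) * h (s * y, s)) \<partial>lborel) =
        (\<integral>\<^sup>+r. ennreal (\<bar>r\<bar> * w (r\<^sup>2)) * ennreal (inverse (1 + y\<^sup>2)) * h (polar (r, y)) \<partial>lborel)" .
  qed
  also have "\<dots> = (\<integral>\<^sup>+z. ennreal (\<bar>fst z\<bar> * w ((fst z)\<^sup>2)) * ennreal (inverse (1 + (snd z)\<^sup>2)) * h (polar z) \<partial>(lborel \<Otimes>\<^sub>M lborel))"
    by (subst lborel_pair.nn_integral_snd [symmetric]) (auto simp: split_beta')
  also have "\<dots> = (\<integral>\<^sup>+z. h (polar z) \<partial>(radial \<Otimes>\<^sub>M cauchy))"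
    unfolding rc by (subst nn_integral_density) (auto simp: case_prod_beta)
  also have "\<dots> = (\<integral>\<^sup>+z. h z \<partial>distr (radial \<Otimes>\<^sub>M cauchy) (borel \<Otimes>\<^sub>M borel) polar)"
    by (subst nn_integral_distr) auto
  also have "\<dots> = emeasure (distr (radial \<Otimes>\<^sub>M cauchy) (borel \<Otimes>\<^sub>M borel) polar) E"
    by (simp add: h_def)
  finally show "emeasure (distr (radial \<Otimes>\<^sub>M cauchy) (borel \<Otimes>\<^sub>M borel) polar) E = emeasure (gauss \<Otimes>\<^sub>M gauss) E"
    by simp
qed (simp cong: sets_pair_measure_cong)

section \<open>Rotation invariance\<close>

text \<open>
  For \<open>u \<noteq> 0\<close> the rotation splits into two affine substitutions, one in each variable, with
  Jacobians \<open>1 / \<bar>u\<bar>\<close> and \<open>\<bar>u\<bar>\<close>. For \<open>u = 0\<close> it exchanges the axes, up to a reflection.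
\<close>

lemma nn_integral_rotation:
  fixes F :: "real \<times> real \<Rightarrow> ennreal"
  assumes F [measurable]: "F \<in> borel_measurable (borel \<Otimes>\<^sub>M borel)" and uv: "u\<^sup>2 + v\<^sup>2 = 1"
  shows "(\<integral>\<^sup>+z. F (u * fst z - v * snd z, v * fst z + u * snd z) \<partial>(lborel \<Otimes>\<^sub>M lborel)) =
    (\<integral>\<^sup>+z. F z \<partial>(lborel \<Otimes>\<^sub>M lborel))" (is "?L = ?R")
proof -
  have L: "?L = (\<integral>\<^sup>+y. \<integral>\<^sup>+x. F (u * x - v * y, v * x + u * y) \<partial>lborel \<partial>lborel)"
    by (subst lborel_pair.nn_integral_snd [symmetric]) (auto simp: split_beta')
  have R: "(\<integral>\<^sup>+a. \<integral>\<^sup>+b. F (a, b) \<partial>lborel \<partial>lborel) = ?R"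
    by (rule lborel.nn_integral_fst) simp
  show ?thesis
  proof (cases "u = 0")
    case False
    have "?L = (\<integral>\<^sup>+y. \<integral>\<^sup>+a. ennreal \<bar>1 / u\<bar> * F (a, (v * a + y) / u) \<partial>lborel \<partial>lborel)"
      unfolding L
    proof (rule nn_integral_cong)
      fix y :: real
      have "(\<integral>\<^sup>+x. F (u * x - v * y, v * x + u * y) \<partial>lborel) = ennreal \<bar>1 / u\<bar> *
          (\<integral>\<^sup>+a. F (u * (v * y / u + 1 / u * a) - v * y, v * (v * y / u + 1 / u * a) + u * y) \<partial>lborel)"
        using False by (intro nn_integral_real_affine) simp_all
      also have "\<dots> = ennreal \<bar>1 / u\<bar> * (\<integral>\<^sup>+a. F (a, (v * a + y) / u) \<partial>lborel)"
      proof -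
        have "u * (v * y / u + 1 / u * a) - v * y = a" for a
          using False by (simp add: field_simps)
        moreover have "v * (v * y / u + 1 / u * a) + u * y = (v * a + y) / u" for a
        proof -
          have "v * (v * y / u + 1 / u * a) + u * y = (v * a + (u\<^sup>2 + v\<^sup>2) * y) / u"
            using False by (simp add: field_simps power2_eq_square)
          then show ?thesis by (simp add: uv)
        qed
        ultimately show ?thesis by simp
      qed
      also have "\<dots> = (\<integral>\<^sup>+a. ennreal \<bar>1 / u\<bar> * F (a, (v * a + y) / u) \<partial>lborel)"
        by (rule nn_integral_cmult [symmetric]) measurable
      finally show "(\<integral>\<^sup>+x. F (u * x - v * y, v * x + u * y) \<partial>lborel) =
        (\<integral>\<^sup>+a. ennreal \<bar>1 / u\<bar> * F (a, (v * a + y) / u) \<partial>lborel)" .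
    qed
    also have "\<dots> = (\<integral>\<^sup>+a. \<integral>\<^sup>+y. ennreal \<bar>1 / u\<bar> * F (a, (v * a + y) / u) \<partial>lborel \<partial>lborel)"
      by (rule lborel_pair.Fubini') measurable
    also have "\<dots> = (\<integral>\<^sup>+a. \<integral>\<^sup>+b. F (a, b) \<partial>lborel \<partial>lborel)"
    proof (rule nn_integral_cong)
      fix a :: real
      have "(\<integral>\<^sup>+y. ennreal \<bar>1 / u\<bar> * F (a, (v * a + y) / u) \<partial>lborel) =
          ennreal \<bar>u\<bar> * (\<integral>\<^sup>+b. ennreal \<bar>1 / u\<bar> * F (a, (v * a + (- (v * a) + u * b)) / u) \<partial>lborel)"
        using False by (intro nn_integral_real_affine) simp_all
      also have "\<dots> = ennreal \<bar>u\<bar> * (ennreal \<bar>1 / u\<bar> * (\<integral>\<^sup>+b. F (a, b) \<partial>lborel))"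
        using False by (simp add: nn_integral_cmult)
      also have "\<dots> = (\<integral>\<^sup>+b. F (a, b) \<partial>lborel)"
        using False by (simp add: mult.assoc [symmetric] ennreal_mult' [symmetric])
      finally show "(\<integral>\<^sup>+y. ennreal \<bar>1 / u\<bar> * F (a, (v * a + y) / u) \<partial>lborel) =
        (\<integral>\<^sup>+b. F (a, b) \<partial>lborel)" .
    qed
    finally show ?thesis unfolding R .
  next
    case True
    then have "v = 1 \<or> v = - 1"
      using uv by (simp add: power2_eq_1_iff)
    then have v: "\<bar>v\<bar> = 1" "v \<noteq> 0" "v * v = 1"
      by auto
    have "?L = (\<integral>\<^sup>+y. \<integral>\<^sup>+b. F (- v * y, b) \<partial>lborel \<partial>lborel)"
      unfolding L
    proof (rule nn_integral_cong)
      fix y :: real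
      show "(\<integral>\<^sup>+x. F (u * x - v * y, v * x + u * y) \<partial>lborel) = (\<integral>\<^sup>+b. F (- v * y, b) \<partial>lborel)"
        using True v by (subst nn_integral_real_affine[where c=v and t=0])
          (simp_all add: mult.assoc [symmetric])
    qed
    also have "\<dots> = (\<integral>\<^sup>+a. \<integral>\<^sup>+b. F (a, b) \<partial>lborel \<partial>lborel)"
      using v by (subst (2) nn_integral_real_affine[where c="- v" and t=0]) simp_all
    finally show ?thesis unfolding R .
  qed
qed

lemma distr_gauss_pair_rotation:
  assumes "u\<^sup>2 + v\<^sup>2 = 1"
  shows "distr (gauss \<Otimes>\<^sub>M gauss) (borel \<Otimes>\<^sub>M borel) (\<lambda>(x, y). (u * x - v * y, v * x + u * y)) =
    gauss \<Otimes>\<^sub>M gauss" (is "distr ?G ?B ?R = _")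
proof (rule measure_eqI)
  fix E assume "E \<in> sets (distr ?G ?B ?R)"
  then have E [measurable]: "E \<in> sets (borel \<Otimes>\<^sub>M borel)" by simp
  define F :: "real \<times> real \<Rightarrow> ennreal" where
    "F z = ennreal (exp (- ((fst z)\<^sup>2 + (snd z)\<^sup>2) / 2) / (2 * pi)) * indicator E z" for z
  have F [measurable]: "F \<in> borel_measurable (borel \<Otimes>\<^sub>M borel)"
    unfolding F_def by measurable
  have norm: "(u * x - v * y)\<^sup>2 + (v * x + u * y)\<^sup>2 = x\<^sup>2 + y\<^sup>2" for x y
  proof -
    have "(u * x - v * y)\<^sup>2 + (v * x + u * y)\<^sup>2 = (u\<^sup>2 + v\<^sup>2) * (x\<^sup>2 + y\<^sup>2)" by algebra
    then show ?thesis using assms by simp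
  qed
  have "emeasure (distr ?G ?B ?R) E = (\<integral>\<^sup>+z. indicator E z \<partial>distr ?G ?B ?R)"
    by simp
  also have "\<dots> = (\<integral>\<^sup>+z. indicator E (?R z) \<partial>?G)"
    by (subst nn_integral_distr) auto
  also have "\<dots> = (\<integral>\<^sup>+z. F (u * fst z - v * snd z, v * fst z + u * snd z) \<partial>(lborel \<Otimes>\<^sub>M lborel))"
    unfolding gauss_pair_density
    by (subst nn_integral_density) (auto simp: F_def norm case_prod_beta)
  also have "\<dots> = (\<integral>\<^sup>+z. F z \<partial>(lborel \<Otimes>\<^sub>M lborel))"
    by (rule nn_integral_rotation) fact+
  also have "\<dots> = emeasure ?G E"
    unfolding gauss_pair_density by (simp add: emeasure_density F_def case_prod_beta)
  finally show "emeasure (distr ?G ?B ?R) E = emeasure ?G E" .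
qed (simp cong: sets_pair_measure_cong)

section \<open>The standard Gaussian vector in the plane\<close>

lemma measurable_vector_pair [measurable]:
  "(\<lambda>(x, y). vector [x, y] :: real^2) \<in> borel_measurable (borel \<Otimes>\<^sub>M borel)"
proof -
  have "(\<lambda>(x, y). vector [x, y] :: real^2) = (\<lambda>z. fst z *\<^sub>R axis 1 1 + snd z *\<^sub>R axis 2 1)"
    by (auto simp: fun_eq_iff vec_eq_iff forall_2 axis_def)
  then show ?thesis by simp
qed

lemma distr_lborel_vector_pair:
  "distr (lborel \<Otimes>\<^sub>M lborel) borel (\<lambda>(x, y). vector [x, y]) = (lborel :: (real^2) measure)"
proof (rule lborel_eqI [symmetric])
  fix l u :: "real^2"
  assume le: "\<And>b. b \<in> Basis \<Longrightarrow> l \<bullet> b \<le> u \<bullet> b"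
  have "l $ i \<le> u $ i" for i
    using le[of "axis i 1"] by (simp add: inner_axis)
  then have lu: "l $ 1 \<le> u $ 1" "l $ 2 \<le> u $ 2" by auto
  have "emeasure (distr (lborel \<Otimes>\<^sub>M lborel) borel (\<lambda>(x, y). vector [x, y])) (box l u) =
      emeasure (lborel \<Otimes>\<^sub>M lborel) ({l $ 1<..<u $ 1} \<times> {l $ 2<..<u $ 2})"
    by (subst emeasure_distr)
      (auto simp: mem_box_cart forall_2 space_pair_measure intro!: arg_cong2[where f=emeasure])
  also have "\<dots> = ennreal (u $ 1 - l $ 1) * ennreal (u $ 2 - l $ 2)"
    using lu by (subst lborel.emeasure_pair_measure_Times) auto
  also have "\<dots> = ennreal (\<Prod>i\<in>UNIV. (u - l) $ i)"
    using lu by (simp add: UNIV_2 ennreal_mult)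
  also have "(\<Prod>i\<in>UNIV. (u - l) $ i) = (\<Prod>b\<in>Basis. (u - l) \<bullet> b)"
  proof -
    have B: "(Basis :: (real^2) set) = (\<lambda>i. axis i 1) ` UNIV"
      by (auto simp: Basis_vec_def)
    show ?thesis
      unfolding B by (subst prod.reindex) (auto simp: inj_on_def axis_eq_axis inner_axis)
  qed
  finally show "emeasure (distr (lborel \<Otimes>\<^sub>M lborel) borel (\<lambda>(x, y). vector [x, y])) (box l u) =
      (\<Prod>b\<in>Basis. (u - l) \<bullet> b)" .
qed simp

lemma std_gaussian_eq_distr:
  "(std_gaussian :: (real^2) measure) = distr (gauss \<Otimes>\<^sub>M gauss) borel (\<lambda>(x, y). vector [x, y])"
    (is "_ = distr _ _ ?vec")
proof -
  have "(std_gaussian :: (real^2) measure) =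
      density (distr (lborel \<Otimes>\<^sub>M lborel) borel (\<lambda>(x, y). vector [x, y]))
        (\<lambda>x. ennreal (\<Prod>i\<in>UNIV. std_normal_density (x $ i)))"
    by (simp add: std_gaussian_def distr_lborel_vector_pair)
  also have "\<dots> = distr (density (lborel \<Otimes>\<^sub>M lborel)
      (\<lambda>z. ennreal (\<Prod>i\<in>UNIV. std_normal_density ((?vec z :: real^2) $ i))))
      borel (\<lambda>(x, y). vector [x, y])"
    by (rule density_distr) (auto simp: UNIV_2)
  also have "(\<lambda>z. ennreal (\<Prod>i\<in>UNIV. std_normal_density ((?vec z :: real^2) $ i))) =
     (\<lambda>(x, y). ennreal (exp (- (x\<^sup>2 + y\<^sup>2) / 2) / (2 * pi)))"
    by (auto simp: fun_eq_iff UNIV_2 std_normal_density_pair)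
  finally show ?thesis unfolding gauss_pair_density .
qed

section \<open>A transformation preserving the law of the squares\<close>

text \<open>
  The squared coordinates of the point with radius \<open>r\<close> and ratio \<open>p\<close>, where \<open>p\<close> is the Boole
  transform of \<open>y\<close>, in terms of the point with radius \<open>r\<close> and ratio \<open>y\<close>. The reason is
  \<open>1 + p\<^sup>2 = (1 + y\<^sup>2) (y\<^sup>2 + k\<^sup>2) / ((1 + k)\<^sup>2 y\<^sup>2)\<close>. At \<open>y = 0\<close>, where
  \<open>k / 0 = 0\<close> gives \<open>p = 0\<close>, the second identity fails unless \<open>r = 0\<close>.
\<close>

lemma Boole_polar_identity:
  fixes k r y :: real
  assumes "0 \<le> k" "y \<noteq> 0"
  defines "p \<equiv> (y - k / y) / (1 + k)"
  shows "((r * y / sqrt (1 + y\<^sup>2))\<^sup>2 - k * (r / sqrt (1 + y\<^sup>2))\<^sup>2)\<^sup>2 /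
      ((r * y / sqrt (1 + y\<^sup>2))\<^sup>2 + k\<^sup>2 * (r / sqrt (1 + y\<^sup>2))\<^sup>2) = (r * p / sqrt (1 + p\<^sup>2))\<^sup>2"
    and "((1 + k) * (r * y / sqrt (1 + y\<^sup>2)) * (r / sqrt (1 + y\<^sup>2)))\<^sup>2 /
      ((r * y / sqrt (1 + y\<^sup>2))\<^sup>2 + k\<^sup>2 * (r / sqrt (1 + y\<^sup>2))\<^sup>2) = (r / sqrt (1 + p\<^sup>2))\<^sup>2"
proof -
  define n where "n = 1 + y\<^sup>2"
  define d where "d = y\<^sup>2 + k\<^sup>2"
  have n: "n > 0" and d: "d > 0"
    using assms(2) by (simp_all add: n_def d_def add_pos_nonneg)
  have sn: "(sqrt n)\<^sup>2 = n" using n by simp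
  have sq: "(r * y / sqrt n)\<^sup>2 = r\<^sup>2 * y\<^sup>2 / n" "(r / sqrt n)\<^sup>2 = r\<^sup>2 / n"
    by (simp_all add: power_divide power_mult_distrib sn)
  have p: "p = (y\<^sup>2 - k) / ((1 + k) * y)"
    using assms by (simp add: p_def field_simps power2_eq_square)
  have "1 + p\<^sup>2 = ((1 + k)\<^sup>2 * y\<^sup>2 + (y\<^sup>2 - k)\<^sup>2) / ((1 + k)\<^sup>2 * y\<^sup>2)"
    using assms(1,2) by (simp add: p power_divide power_mult_distrib add_divide_distrib)
  also have "(1 + k)\<^sup>2 * y\<^sup>2 + (y\<^sup>2 - k)\<^sup>2 = n * d"
    unfolding n_def d_def by algebra
  finally have p1: "1 + p\<^sup>2 = n * d / ((1 + k)\<^sup>2 * y\<^sup>2)" .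
  have sp: "(sqrt (1 + p\<^sup>2))\<^sup>2 = 1 + p\<^sup>2" by simp
  have den: "r\<^sup>2 * y\<^sup>2 / n + k\<^sup>2 * (r\<^sup>2 / n) = r\<^sup>2 * d / n"
    by (simp add: d_def algebra_simps add_divide_distrib)
  have num1: "r\<^sup>2 * y\<^sup>2 / n - k * (r\<^sup>2 / n) = r\<^sup>2 * (y\<^sup>2 - k) / n"
    by (simp add: algebra_simps diff_divide_distrib)
  have num2: "((1 + k) * (r * y / sqrt n) * (r / sqrt n))\<^sup>2 = (1 + k)\<^sup>2 * (r\<^sup>2 * y\<^sup>2 / n) * (r\<^sup>2 / n)"
    unfolding power_mult_distrib sq ..
  have "(r\<^sup>2 * (y\<^sup>2 - k) / n)\<^sup>2 / (r\<^sup>2 * d / n) = r\<^sup>2 * (y\<^sup>2 - k)\<^sup>2 / (n * d)"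
    using n d by (cases "r = 0") (simp_all add: field_simps power2_eq_square)
  also have "\<dots> = (r * p / sqrt (1 + p\<^sup>2))\<^sup>2"
    using n d assms(1,2) unfolding power_divide power_mult_distrib sp p1
    by (simp add: p power_divide power_mult_distrib)
  finally show "((r * y / sqrt (1 + y\<^sup>2))\<^sup>2 - k * (r / sqrt (1 + y\<^sup>2))\<^sup>2)\<^sup>2 /
      ((r * y / sqrt (1 + y\<^sup>2))\<^sup>2 + k\<^sup>2 * (r / sqrt (1 + y\<^sup>2))\<^sup>2) = (r * p / sqrt (1 + p\<^sup>2))\<^sup>2"
    unfolding n_def [symmetric] sq den num1 .
  have "(1 + k)\<^sup>2 * (r\<^sup>2 * y\<^sup>2 / n) * (r\<^sup>2 / n) / (r\<^sup>2 * d / n) = r\<^sup>2 * ((1 + k)\<^sup>2 * y\<^sup>2) / (n * d)"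
    using n d by (cases "r = 0") (simp_all add: field_simps power2_eq_square)
  also have "\<dots> = (r / sqrt (1 + p\<^sup>2))\<^sup>2"
    unfolding power_divide sp unfolding p1 by simp
  finally show "((1 + k) * (r * y / sqrt (1 + y\<^sup>2)) * (r / sqrt (1 + y\<^sup>2)))\<^sup>2 /
      ((r * y / sqrt (1 + y\<^sup>2))\<^sup>2 + k\<^sup>2 * (r / sqrt (1 + y\<^sup>2))\<^sup>2) = (r / sqrt (1 + p\<^sup>2))\<^sup>2"
    unfolding n_def [symmetric] num2 unfolding sq den .
qed

lemma distr_gauss_pair_Boole:
  fixes k :: real
  assumes k: "0 \<le> k"
  shows "distr (gauss \<Otimes>\<^sub>M gauss) (borel \<Otimes>\<^sub>M borel)
      (\<lambda>(x, y). ((x\<^sup>2 - k * y\<^sup>2)\<^sup>2 / (x\<^sup>2 + k\<^sup>2 * y\<^sup>2), ((1 + k) * x * y)\<^sup>2 / (x\<^sup>2 + k\<^sup>2 * y\<^sup>2))) =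
    distr (gauss \<Otimes>\<^sub>M gauss) (borel \<Otimes>\<^sub>M borel) (\<lambda>(x, y). (x\<^sup>2, y\<^sup>2))"
    (is "distr ?G ?B ?T = distr _ _ ?Q")
proof -
  let ?RC = "radial \<Otimes>\<^sub>M cauchy"
  let ?p = "\<lambda>y :: real. (y - k / y) / (1 + k)"
  let ?b = "\<lambda>(r :: real, y). (r, ?p y)"
  interpret C: finite_measure cauchy by (rule finite_measure_cauchy)
  \<comment> \<open>The points of ratio \<open>0\<close>, excluded in \<open>Boole_polar_identity\<close>, form a null set.\<close>
  have AE: "AE z in ?RC. snd z \<noteq> 0"
  proof -
    have "emeasure ?RC (UNIV \<times> {0}) = 0"
    proof (subst C.emeasure_pair_measure_Times)
      have "emeasure cauchy {0} = 0"
        using AE_cauchy_nonzero by (subst (asm) AE_iff_measurable[OF _ refl]) auto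
      then show "emeasure radial UNIV * emeasure cauchy {0} = 0" by simp
    qed auto
    then show ?thesis
      by (intro AE_I[where N="UNIV \<times> {0}"]) (auto simp: pair_measureI)
  qed
  have b: "distr ?RC ?B ?b = ?RC"
  proof -
    have "distr radial borel (\<lambda>r. r) \<Otimes>\<^sub>M distr cauchy borel ?p = distr ?RC ?B ?b"
      by (rule pair_measure_distr)
        (auto simp: distr_cauchy_Boole[OF k] C.sigma_finite_measure_axioms)
    moreover have "distr radial borel (\<lambda>r. r) = radial"
      by (rule distr_id2) simp
    ultimately show ?thesis by (simp add: distr_cauchy_Boole[OF k])
  qed
  have "distr ?G ?B ?T = distr ?RC ?B (?T \<circ> polar)"
    unfolding distr_polar [symmetric] by (subst distr_distr) auto
  also have "\<dots> = distr ?RC ?B ((?Q \<circ> polar) \<circ> ?b)"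
  proof (rule distr_cong_AE)
    show "AE z in ?RC. (?T \<circ> polar) z = ((?Q \<circ> polar) \<circ> ?b) z"
      using AE
    proof eventually_elim
      case (elim z)
      then show ?case
        using Boole_polar_identity[OF k, of "snd z" "fst z"]
        by (cases z) (simp add: polar_def)
    qed
  qed auto
  also have "\<dots> = distr (distr ?RC ?B ?b) ?B (?Q \<circ> polar)"
    by (subst distr_distr) auto
  also have "\<dots> = distr (distr ?RC ?B polar) ?B ?Q"
    unfolding b by (subst distr_distr) auto
  finally show ?thesis unfolding distr_polar .
qed

section \<open>The diagonal case\<close>

lemma chi_square_1: "chi_square 1 = distr gauss borel (\<lambda>x. x\<^sup>2)"
proof -
  let ?P = "PiM {..<1::nat} (\<lambda>_. gauss)"
  have "distr ?P gauss (\<lambda>z. z 0) = gauss"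
    by (rule distr_PiM_component) (auto simp: prob_space_gauss)
  then have "distr gauss borel (\<lambda>x. x\<^sup>2) = distr (distr ?P gauss (\<lambda>z. z 0)) borel (\<lambda>x. x\<^sup>2)"
    by simp
  also have "\<dots> = distr ?P borel (\<lambda>z. (z 0)\<^sup>2)"
    by (subst distr_distr) (auto simp: comp_def)
  finally show ?thesis by (simp add: chi_square_def gauss_def)
qed

lemma distr_gauss_pair_indefinite:
  fixes l m :: real
  assumes "l \<noteq> 0" "l * m \<le> 0"
  shows "distr (gauss \<Otimes>\<^sub>M gauss) borel
      (\<lambda>(x, y). (l * x\<^sup>2 + m * y\<^sup>2)\<^sup>2 / (l\<^sup>2 * x\<^sup>2 + m\<^sup>2 * y\<^sup>2)) = chi_square 1"
proof -
  let ?G = "gauss \<Otimes>\<^sub>M gauss"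
  interpret g: prob_space gauss by (rule prob_space_gauss)
  define k where "k = - (m / l)"
  have k: "0 \<le> k" using assms by (auto simp: k_def divide_le_0_iff mult_le_0_iff)
  have m: "m = - (k * l)" using assms by (simp add: k_def)
  have "(l * x\<^sup>2 + m * y\<^sup>2)\<^sup>2 / (l\<^sup>2 * x\<^sup>2 + m\<^sup>2 * y\<^sup>2) = (x\<^sup>2 - k * y\<^sup>2)\<^sup>2 / (x\<^sup>2 + k\<^sup>2 * y\<^sup>2)" for x y
  proof -
    have "(l * x\<^sup>2 + m * y\<^sup>2)\<^sup>2 = l\<^sup>2 * (x\<^sup>2 - k * y\<^sup>2)\<^sup>2" "l\<^sup>2 * x\<^sup>2 + m\<^sup>2 * y\<^sup>2 = l\<^sup>2 * (x\<^sup>2 + k\<^sup>2 * y\<^sup>2)"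
      unfolding m by algebra+
    then show ?thesis using assms(1) by simp
  qed
  then have "distr ?G borel (\<lambda>(x, y). (l * x\<^sup>2 + m * y\<^sup>2)\<^sup>2 / (l\<^sup>2 * x\<^sup>2 + m\<^sup>2 * y\<^sup>2)) =
      distr ?G borel (fst \<circ> (\<lambda>(x, y). ((x\<^sup>2 - k * y\<^sup>2)\<^sup>2 / (x\<^sup>2 + k\<^sup>2 * y\<^sup>2), ((1 + k) * x * y)\<^sup>2 / (x\<^sup>2 + k\<^sup>2 * y\<^sup>2))))"
    by (intro distr_cong) auto
  also have "\<dots> = distr (distr ?G (borel \<Otimes>\<^sub>M borel) (\<lambda>(x, y). ((x\<^sup>2 - k * y\<^sup>2)\<^sup>2 / (x\<^sup>2 + k\<^sup>2 * y\<^sup>2), ((1 + k) * x * y)\<^sup>2 / (x\<^sup>2 + k\<^sup>2 * y\<^sup>2)))) borel fst"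
    by (subst distr_distr) auto
  also have "\<dots> = distr (distr ?G (borel \<Otimes>\<^sub>M borel) (\<lambda>(x, y). (x\<^sup>2, y\<^sup>2))) borel fst"
    by (simp only: distr_gauss_pair_Boole[OF k])
  also have "\<dots> = distr ?G borel ((\<lambda>x. x\<^sup>2) \<circ> fst)"
    by (subst distr_distr) (auto intro!: distr_cong)
  also have "\<dots> = distr (distr ?G gauss fst) borel (\<lambda>x. x\<^sup>2)"
    by (subst distr_distr) auto
  also have "distr ?G gauss fst = gauss"
    by (rule g.distr_pair_fst)
  finally show ?thesis unfolding chi_square_1 .
qed

lemma distr_gauss_pair_definite:
  fixes l m :: real
  assumes "0 < l * m"
  shows "distr (gauss \<Otimes>\<^sub>M gauss) borel
      (\<lambda>(x, y). (l * x\<^sup>2 + m * y\<^sup>2)\<^sup>2 / (l\<^sup>2 * x\<^sup>2 + m\<^sup>2 * y\<^sup>2)) =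
    distr (gauss \<Otimes>\<^sub>M gauss) borel (\<lambda>(x, y). x\<^sup>2 + 4 * (l * m) / (l + m)\<^sup>2 * y\<^sup>2)"
proof -
  let ?G = "gauss \<Otimes>\<^sub>M gauss"
  define k where "k = m / l"
  define c where "c = 4 * k / (1 + k)\<^sup>2"
  let ?c = "\<lambda>(s, t). s + c * t"
  have l: "l \<noteq> 0" using assms by auto
  have k: "0 < k" using assms by (auto simp: k_def zero_less_mult_iff zero_less_divide_iff)
  have m: "m = k * l" using l by (simp add: k_def)
  have c: "4 * (l * m) / (l + m)\<^sup>2 = c"
  proof -
    have "4 * (l * m) = l\<^sup>2 * (4 * k)" "(l + m)\<^sup>2 = l\<^sup>2 * (1 + k)\<^sup>2"
      unfolding m by algebra+
    then show ?thesis using l by (simp add: c_def)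
  qed
  have "(l * x\<^sup>2 + m * y\<^sup>2)\<^sup>2 / (l\<^sup>2 * x\<^sup>2 + m\<^sup>2 * y\<^sup>2) =
    (x\<^sup>2 - k * y\<^sup>2)\<^sup>2 / (x\<^sup>2 + k\<^sup>2 * y\<^sup>2) + c * (((1 + k) * x * y)\<^sup>2 / (x\<^sup>2 + k\<^sup>2 * y\<^sup>2))" for x y
  proof -
    have 1: "(l * x\<^sup>2 + m * y\<^sup>2)\<^sup>2 = l\<^sup>2 * ((x\<^sup>2 - k * y\<^sup>2)\<^sup>2 + 4 * k * (x * y)\<^sup>2)"
      "l\<^sup>2 * x\<^sup>2 + m\<^sup>2 * y\<^sup>2 = l\<^sup>2 * (x\<^sup>2 + k\<^sup>2 * y\<^sup>2)"
      unfolding m by algebra+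
    have "c * ((1 + k) * x * y)\<^sup>2 = 4 * k * (x * y)\<^sup>2"
      using k by (simp add: c_def power_mult_distrib)
    then show ?thesis unfolding 1 using l by (simp add: add_divide_distrib)
  qed
  then have "distr ?G borel (\<lambda>(x, y). (l * x\<^sup>2 + m * y\<^sup>2)\<^sup>2 / (l\<^sup>2 * x\<^sup>2 + m\<^sup>2 * y\<^sup>2)) =
      distr ?G borel (?c \<circ> (\<lambda>(x, y). ((x\<^sup>2 - k * y\<^sup>2)\<^sup>2 / (x\<^sup>2 + k\<^sup>2 * y\<^sup>2), ((1 + k) * x * y)\<^sup>2 / (x\<^sup>2 + k\<^sup>2 * y\<^sup>2))))"
    by (intro distr_cong) auto
  also have "\<dots> = distr (distr ?G (borel \<Otimes>\<^sub>M borel) (\<lambda>(x, y). ((x\<^sup>2 - k * y\<^sup>2)\<^sup>2 / (x\<^sup>2 + k\<^sup>2 * y\<^sup>2), ((1 + k) * x * y)\<^sup>2 / (x\<^sup>2 + k\<^sup>2 * y\<^sup>2)))) borel ?c"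
    by (subst distr_distr) auto
  also have "\<dots> = distr (distr ?G (borel \<Otimes>\<^sub>M borel) (\<lambda>(x, y). (x\<^sup>2, y\<^sup>2))) borel ?c"
    by (simp only: distr_gauss_pair_Boole[OF less_imp_le[OF k]])
  also have "\<dots> = distr ?G borel (\<lambda>(x, y). x\<^sup>2 + c * y\<^sup>2)"
    by (subst distr_distr) (auto intro!: distr_cong)
  finally show ?thesis unfolding c .
qed

section \<open>Reduction to the diagonal case\<close>

text \<open>
  The rotation by the angle with cosine \<open>u\<close> and sine \<open>v\<close> diagonalizes the nonzero symmetric
  matrix with rows \<open>(p, q)\<close> and \<open>(q, r)\<close>; the
  eigenvalues \<open>l\<close>, \<open>m\<close> can be ordered so that the first one is nonzero.
\<close>

lemma symmetric_2_diagonalize: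
  fixes p q r :: real
  assumes "p \<noteq> 0 \<or> q \<noteq> 0 \<or> r \<noteq> 0"
  obtains u v l m :: real where "u\<^sup>2 + v\<^sup>2 = 1" "l \<noteq> 0"
    "p = l * u\<^sup>2 + m * v\<^sup>2" "q = (l - m) * u * v" "r = l * v\<^sup>2 + m * u\<^sup>2"
proof -
  \<comment> \<open>The angle of rotation is half a polar angle of \<open>((p - r) / 2, q)\<close>.\<close>
  obtain d t where dt: "(p - r) / 2 = d * cos t" "q = d * sin t"
    using polar_Ex[of "(p - r) / 2" q] by blast
  define u v where "u = cos (t / 2)" and "v = sin (t / 2)"
  define l m where "l = (p + r) / 2 + d" and "m = (p + r) / 2 - d"
  have uv: "u\<^sup>2 + v\<^sup>2 = 1" by (simp add: u_def v_def)
  have ct: "cos t = u\<^sup>2 - v\<^sup>2" and st: "sin t = 2 * u * v"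
    using cos_double[of "t / 2"] sin_double[of "t / 2"] by (simp_all add: u_def v_def mult_ac)
  have P: "p = l * u\<^sup>2 + m * v\<^sup>2"
  proof -
    have "l * u\<^sup>2 + m * v\<^sup>2 = (p + r) / 2 * (u\<^sup>2 + v\<^sup>2) + d * (u\<^sup>2 - v\<^sup>2)"
      by (simp add: l_def m_def algebra_simps)
    also have "\<dots> = (p + r) / 2 + (p - r) / 2" by (simp add: uv dt(1) ct)
    finally show ?thesis by (simp add: field_simps)
  qed
  have R: "r = l * v\<^sup>2 + m * u\<^sup>2"
  proof -
    have "l * v\<^sup>2 + m * u\<^sup>2 = (p + r) / 2 * (u\<^sup>2 + v\<^sup>2) - d * (u\<^sup>2 - v\<^sup>2)"
      by (simp add: l_def m_def algebra_simps)
    also have "\<dots> = (p + r) / 2 - (p - r) / 2" by (simp add: uv dt(1) ct)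
    finally show ?thesis by (simp add: field_simps)
  qed
  have Q: "q = (l - m) * u * v"
    by (simp add: dt(2) st l_def m_def)
  show thesis
  proof (cases "l = 0")
    case False
    show thesis by (rule that[OF uv False P Q R])
  next
    case True
    then have "m \<noteq> 0" using assms P Q R by auto
    then show thesis
      using uv P Q R by (intro that[of "- v" u m l]) (simp_all add: algebra_simps)
  qed
qed

text \<open>
  Here \<open>g\<close> is half the gradient, whence the factor \<open>4\<close>. Where the denominator vanishes both sides are \<open>0\<close>.
\<close>

lemma W_quadratic_form:
  fixes a b c :: real and S :: "real^2^2" and x :: "real^2"
  defines "g \<equiv> vector [a * x $ 1 + b * x $ 2, b * x $ 1 + c * x $ 2] :: real^2"
  shows "4 * W (\<lambda>x. a * (x $ 1)\<^sup>2 + 2 * b * (x $ 1) * (x $ 2) + c * (x $ 2)\<^sup>2) S x =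
    (a * (x $ 1)\<^sup>2 + 2 * b * (x $ 1) * (x $ 2) + c * (x $ 2)\<^sup>2)\<^sup>2 / (g \<bullet> (S *v g))"
proof -
  let ?f = "\<lambda>x :: real^2. a * (x $ 1)\<^sup>2 + 2 * b * (x $ 1) * (x $ 2) + c * (x $ 2)\<^sup>2"
  have nth: "((\<lambda>x. x $ i) has_derivative (\<lambda>h. h $ i)) (at x)" for i
    by (rule bounded_linear_imp_has_derivative[OF bounded_linear_vec_nth])
  have "GDERIV ?f x :> 2 *\<^sub>R g"
    unfolding gderiv_def
    by (auto intro!: derivative_eq_intros nth simp: fun_eq_iff g_def inner_vec_def sum_2 algebra_simps power2_eq_square)
  then have "gradient ?f x = 2 *\<^sub>R g" by (rule gradient_eqI)
  then show ?thesis
    by (simp add: W_def matrix_vector_mult_scaleR)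
qed

text \<open>
  The numbers \<open>p\<close>, \<open>q\<close>, \<open>r\<close> are the entries of \<open>C = B\<^sup>T A B\<close>, and the right hand side is
  \<open>(z\<^sup>T C z)\<^sup>2 / \<bar>C z\<bar>\<^sup>2\<close>.
\<close>

lemma W_quadratic_form_factor:
  fixes a b c :: real and B :: "real^2^2" and z :: "real^2"
  defines "p \<equiv> a * (B$1$1)\<^sup>2 + 2 * b * B$1$1 * B$2$1 + c * (B$2$1)\<^sup>2"
    and "q \<equiv> a * B$1$1 * B$1$2 + b * (B$1$1 * B$2$2 + B$1$2 * B$2$1) + c * B$2$1 * B$2$2"
    and "r \<equiv> a * (B$1$2)\<^sup>2 + 2 * b * B$1$2 * B$2$2 + c * (B$2$2)\<^sup>2"
  shows "4 * W (\<lambda>x. a * (x $ 1)\<^sup>2 + 2 * b * (x $ 1) * (x $ 2) + c * (x $ 2)\<^sup>2) (B ** transpose B) (B *v z) =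
    (p * (z$1)\<^sup>2 + 2 * q * z$1 * z$2 + r * (z$2)\<^sup>2)\<^sup>2 / ((p * z$1 + q * z$2)\<^sup>2 + (q * z$1 + r * z$2)\<^sup>2)"
proof -
  define x where "x = B *v z"
  have x: "x $ 1 = B$1$1 * z$1 + B$1$2 * z$2" "x $ 2 = B$2$1 * z$1 + B$2$2 * z$2"
    by (simp_all add: x_def matrix_vector_mult_def sum_2)
  define g :: "real^2" where "g = vector [a * x $ 1 + b * x $ 2, b * x $ 1 + c * x $ 2]"
  have "g \<bullet> ((B ** transpose B) *v g) = (transpose B *v g) \<bullet> (transpose B *v g)"
    by (metis dot_lmul_matrix matrix_vector_mul_assoc transpose_matrix_vector)
  also have "\<dots> = (p * z$1 + q * z$2)\<^sup>2 + (q * z$1 + r * z$2)\<^sup>2"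
  proof -
    have "(transpose B *v g) $ 1 = p * z$1 + q * z$2"
      unfolding p_def q_def matrix_vector_mult_def transpose_def
      by (simp add: sum_2 g_def x algebra_simps power2_eq_square)
    moreover have "(transpose B *v g) $ 2 = q * z$1 + r * z$2"
      unfolding q_def r_def matrix_vector_mult_def transpose_def
      by (simp add: sum_2 g_def x algebra_simps power2_eq_square)
    ultimately show ?thesis by (simp add: inner_vec_def sum_2 power2_eq_square)
  qed
  finally have den: "g \<bullet> ((B ** transpose B) *v g) = (p * z$1 + q * z$2)\<^sup>2 + (q * z$1 + r * z$2)\<^sup>2" .
  have num: "a * (x$1)\<^sup>2 + 2 * b * (x$1) * (x$2) + c * (x$2)\<^sup>2 = p * (z$1)\<^sup>2 + 2 * q * z$1 * z$2 + r * (z$2)\<^sup>2"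
    unfolding x p_def q_def r_def by algebra
  show ?thesis
    using W_quadratic_form[of a b c "B ** transpose B" x]
    unfolding num g_def [symmetric] den unfolding x_def .
qed

lemma measurable_W_quadratic_form:
  fixes a b c :: real and S :: "real^2^2"
  shows "W (\<lambda>x. a * (x $ 1)\<^sup>2 + 2 * b * (x $ 1) * (x $ 2) + c * (x $ 2)\<^sup>2) S \<in> borel_measurable borel"
    (is "?W \<in> _")
proof -
  have nth: "(\<lambda>x :: real^2. x $ i) \<in> borel_measurable borel" for i
    by (intro borel_measurable_continuous_onI continuous_intros)
  note [measurable] = nth[of 1] nth[of 2]
  have "?W = (\<lambda>x. 1 / 4 * (4 * ?W x))" by simp
  also have "\<dots> \<in> borel_measurable borel"
    unfolding W_quadratic_form by (simp add: inner_vec_def matrix_vector_mult_def sum_2)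
  finally show ?thesis .
qed

lemma distr_W_diagonal:
  fixes a b c :: real and A S :: "real^2^2" and X :: "'m \<Rightarrow> real^2"
  assumes S: "pos_definite S"
    and A: "A = vector [vector [a, b], vector [b, c]]" and A0: "A \<noteq> 0"
    and X: "centered_gaussian M X S"
  obtains l m :: real where "l \<noteq> 0" "l * m = det (A ** S)" "l + m = trace (A ** S)"
    "distr M borel (\<lambda>\<omega>. 4 * W (\<lambda>x. a * (x $ 1)\<^sup>2 + 2 * b * (x $ 1) * (x $ 2) + c * (x $ 2)\<^sup>2) S (X \<omega>)) =
      distr (gauss \<Otimes>\<^sub>M gauss) borel (\<lambda>(x, y). (l * x\<^sup>2 + m * y\<^sup>2)\<^sup>2 / (l\<^sup>2 * x\<^sup>2 + m\<^sup>2 * y\<^sup>2))"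
proof -
  let ?G = "gauss \<Otimes>\<^sub>M gauss"
  let ?W = "W (\<lambda>x. a * (x $ 1)\<^sup>2 + 2 * b * (x $ 1) * (x $ 2) + c * (x $ 2)\<^sup>2) S"
  have W [measurable]: "?W \<in> borel_measurable borel" by (rule measurable_W_quadratic_form)
  obtain B :: "real^2^2" where B: "B ** transpose B = S"
    and XB: "distr M borel X = distr std_gaussian borel (\<lambda>z. B *v z)"
    and Xm [measurable]: "X \<in> borel_measurable M"
    using X unfolding centered_gaussian_def by blast
  have Bm [measurable]: "(\<lambda>z. B *v z) \<in> borel_measurable borel"
    by (intro borel_measurable_continuous_onI matrix_vector_mult_linear_continuous_on)
  have "det B \<noteq> 0"
  proof
    assume "det B = 0"
    then have "\<not> invertible (transpose B)" by (simp add: invertible_det_nz)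
    then obtain x where x: "x \<noteq> 0" "transpose B *v x = 0"
      using invertible_left_inverse matrix_left_invertible_ker by blast
    then have "S *v x = 0"
      by (metis B matrix_vector_mul_assoc matrix_vector_mult_0_right)
    then show False using S x(1) unfolding pos_definite_def by fastforce
  qed
  then have D: "B$1$1 * B$2$2 - B$1$2 * B$2$1 \<noteq> 0" (is "?D \<noteq> 0") by (simp add: det_2)
  define p q r where "p = a * (B$1$1)\<^sup>2 + 2 * b * B$1$1 * B$2$1 + c * (B$2$1)\<^sup>2"
    and "q = a * B$1$1 * B$1$2 + b * (B$1$1 * B$2$2 + B$1$2 * B$2$1) + c * B$2$1 * B$2$2"
    and "r = a * (B$1$2)\<^sup>2 + 2 * b * B$1$2 * B$2$2 + c * (B$2$2)\<^sup>2"
  have "p \<noteq> 0 \<or> q \<noteq> 0 \<or> r \<noteq> 0"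
  proof (rule ccontr)
    assume "\<not> ?thesis"
    then have 0: "p = 0" "q = 0" "r = 0" by auto
    \<comment> \<open>\<open>A\<close> is recovered from \<open>C = B\<^sup>T A B\<close> through the adjugate of \<open>B\<close>.\<close>
    have "a * ?D\<^sup>2 = p * (B$2$2)\<^sup>2 - 2 * q * B$2$1 * B$2$2 + r * (B$2$1)\<^sup>2"
      "b * ?D\<^sup>2 = - p * B$1$2 * B$2$2 + q * (B$1$1 * B$2$2 + B$1$2 * B$2$1) - r * B$1$1 * B$2$1"
      "c * ?D\<^sup>2 = p * (B$1$2)\<^sup>2 - 2 * q * B$1$1 * B$1$2 + r * (B$1$1)\<^sup>2"
      unfolding p_def q_def r_def by algebra+
    then have "a = 0" "b = 0" "c = 0" using D 0 by simp_all
    then have "A = 0" using A by (simp add: vec_eq_iff forall_2)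
    with A0 show False ..
  qed
  then obtain u v l m where uv: "u\<^sup>2 + v\<^sup>2 = 1" and l: "l \<noteq> 0"
    and pqr: "p = l * u\<^sup>2 + m * v\<^sup>2" "q = (l - m) * u * v" "r = l * v\<^sup>2 + m * u\<^sup>2"
    by (rule symmetric_2_diagonalize)
  have AS: "(A ** S) $ i $ j = (\<Sum>k\<in>UNIV. A $ i $ k * (\<Sum>h\<in>UNIV. B $ k $ h * B $ j $ h))" for i j
    by (simp add: B [symmetric] matrix_matrix_mult_def transpose_def)
  have det: "l * m = det (A ** S)"
  proof -
    have "det (A ** S) = p * r - q\<^sup>2"
      unfolding det_2 AS sum_2 p_def q_def r_def by (simp add: A) algebra
    also have "\<dots> = l * m * (u\<^sup>2 + v\<^sup>2)\<^sup>2" unfolding pqr by algebra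
    finally show ?thesis by (simp add: uv)
  qed
  have trace: "l + m = trace (A ** S)"
  proof -
    have "trace (A ** S) = p + r"
      unfolding trace_def AS sum_2 p_def r_def by (simp add: A) algebra
    also have "\<dots> = (l + m) * (u\<^sup>2 + v\<^sup>2)" unfolding pqr by algebra
    finally show ?thesis by (simp add: uv)
  qed
  let ?vec = "\<lambda>(x, y). vector [x, y] :: real^2"
  let ?R = "\<lambda>(x, y). (u * x - v * y, v * x + u * y)"
  have "distr M borel (\<lambda>\<omega>. 4 * ?W (X \<omega>)) = distr (distr M borel X) borel (\<lambda>x. 4 * ?W x)"
    by (subst distr_distr) (auto simp: comp_def)
  also have "\<dots> = distr (distr (distr ?G borel ?vec) borel (\<lambda>z. B *v z)) borel (\<lambda>x. 4 * ?W x)"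
    by (simp only: XB std_gaussian_eq_distr)
  also have "\<dots> = distr (distr ?G borel ?vec) borel (\<lambda>z. 4 * ?W (B *v z))"
    by (subst distr_distr) (auto simp: comp_def)
  also have "\<dots> = distr (distr (distr ?G (borel \<Otimes>\<^sub>M borel) ?R) borel ?vec) borel (\<lambda>z. 4 * ?W (B *v z))"
    by (simp only: distr_gauss_pair_rotation[OF uv])
  also have "\<dots> = distr ?G borel (\<lambda>z. 4 * ?W (B *v ?vec (?R z)))"
    by (simp add: distr_distr comp_def)
  also have "(\<lambda>z. 4 * ?W (B *v ?vec (?R z))) =
      (\<lambda>(x, y). (l * x\<^sup>2 + m * y\<^sup>2)\<^sup>2 / (l\<^sup>2 * x\<^sup>2 + m\<^sup>2 * y\<^sup>2))"
  proof (intro ext, clarify)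
    fix x y :: real
    define s t where "s = u * x - v * y" and "t = v * x + u * y"
    have 1: "p * s + q * t = l * u * x - m * v * y"
    proof -
      have "p * s + q * t = (u\<^sup>2 + v\<^sup>2) * (l * u * x - m * v * y)"
        unfolding pqr s_def t_def by algebra
      then show ?thesis by (simp add: uv)
    qed
    have 2: "q * s + r * t = l * v * x + m * u * y"
    proof -
      have "q * s + r * t = (u\<^sup>2 + v\<^sup>2) * (l * v * x + m * u * y)"
        unfolding pqr s_def t_def by algebra
      then show ?thesis by (simp add: uv)
    qed
    have "p * s\<^sup>2 + 2 * q * s * t + r * t\<^sup>2 = s * (p * s + q * t) + t * (q * s + r * t)"
      by algebra
    also have "\<dots> = (u\<^sup>2 + v\<^sup>2) * (l * x\<^sup>2 + m * y\<^sup>2)"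
      unfolding 1 2 unfolding s_def t_def by algebra
    finally have num: "p * s\<^sup>2 + 2 * q * s * t + r * t\<^sup>2 = l * x\<^sup>2 + m * y\<^sup>2"
      by (simp add: uv)
    have "(p * s + q * t)\<^sup>2 + (q * s + r * t)\<^sup>2 = (u\<^sup>2 + v\<^sup>2) * (l\<^sup>2 * x\<^sup>2 + m\<^sup>2 * y\<^sup>2)"
      unfolding 1 2 by algebra
    then have den: "(p * s + q * t)\<^sup>2 + (q * s + r * t)\<^sup>2 = l\<^sup>2 * x\<^sup>2 + m\<^sup>2 * y\<^sup>2"
      by (simp add: uv)
    show "4 * ?W (B *v vector [u * x - v * y, v * x + u * y]) = (l * x\<^sup>2 + m * y\<^sup>2)\<^sup>2 / (l\<^sup>2 * x\<^sup>2 + m\<^sup>2 * y\<^sup>2)"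
      using W_quadratic_form_factor[of a b c B "vector [s, t]"]
      unfolding B vector_2 p_def [symmetric] q_def [symmetric] r_def [symmetric] num den
      unfolding s_def t_def .
  qed
  finally show thesis using that l det trace by blast
qed

theorem theorem3p4:
  fixes a b c :: real
    and A S :: "real^2^2"
    and f :: "real^2 \<Rightarrow> real"
    and M :: "'m measure"
    and X :: "'m \<Rightarrow> real^2"
  assumes "pos_definite S"
    and "A = vector [vector [a, b], vector [b, c]]"
    and "A \<noteq> 0"
    and "f = (\<lambda>x. a * (x $ 1)\<^sup>2 + 2 * b * (x $ 1) * (x $ 2) + c * (x $ 2)\<^sup>2)"
    and "prob_space M"
    and "centered_gaussian M X S"
  shows "(b\<^sup>2 - a * c \<ge> 0 \<longrightarrow>
            distr M borel (\<lambda>\<omega>. 4 * W f S (X \<omega>)) = chi_square 1) \<and>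
         (b\<^sup>2 - a * c < 0 \<longrightarrow>
            (\<forall>(N :: 'n measure) Z1 Z2.
               prob_space N \<longrightarrow>
               distributed N lborel Z1 std_normal_density \<longrightarrow>
               distributed N lborel Z2 std_normal_density \<longrightarrow>
               prob_space.indep_var N borel Z1 borel Z2 \<longrightarrow>
               distr M borel (\<lambda>\<omega>. W f S (X \<omega>)) =
               distr N borel (\<lambda>\<omega>. 1 / 4 * ((Z1 \<omega>)\<^sup>2 +
                 4 * det (A ** S) / (trace (A ** S))\<^sup>2 * (Z2 \<omega>)\<^sup>2))))"
proof -
  obtain l m where l: "l \<noteq> 0" and det: "l * m = det (A ** S)" and trace: "l + m = trace (A ** S)"
    and law: "distr M borel (\<lambda>\<omega>. 4 * W f S (X \<omega>)) =
      distr (gauss \<Otimes>\<^sub>M gauss) borel (\<lambda>(x, y). (l * x\<^sup>2 + m * y\<^sup>2)\<^sup>2 / (l\<^sup>2 * x\<^sup>2 + m\<^sup>2 * y\<^sup>2))"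
    unfolding assms(4) by (rule distr_W_diagonal[OF assms(1-3,6)])
  have [measurable]: "X \<in> borel_measurable M" "W f S \<in> borel_measurable borel"
    using assms(6) measurable_W_quadratic_form unfolding centered_gaussian_def assms(4) by auto
  have detS: "0 < det S"
  proof -
    obtain B :: "real^2^2" where B: "B ** transpose B = S"
      using assms(6) unfolding centered_gaussian_def by blast
    have "det S \<noteq> 0"
    proof
      assume "det S = 0"
      then obtain x where "x \<noteq> 0" "S *v x = 0"
        using invertible_det_nz invertible_left_inverse matrix_left_invertible_ker by metis
      then show False using assms(1) unfolding pos_definite_def by fastforce
    qed
    moreover have "det S = (det B)\<^sup>2"
      by (simp add: B [symmetric] det_mul power2_eq_square)
    ultimately show ?thesis by simp
  qed
  have lm: "l * m = (a * c - b\<^sup>2) * det S"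
    by (simp add: det det_mul assms(2)) (simp add: det_2 power2_eq_square)
  show ?thesis
  proof (intro conjI impI allI)
    assume "b\<^sup>2 - a * c \<ge> 0"
    then have "l * m \<le> 0" using detS by (simp add: lm mult_le_0_iff)
    then show "distr M borel (\<lambda>\<omega>. 4 * W f S (X \<omega>)) = chi_square 1"
      unfolding law by (rule distr_gauss_pair_indefinite[OF l])
  next
    fix N :: "'n measure" and Z1 Z2
    assume "b\<^sup>2 - a * c < 0" and N: "prob_space N"
      and Z1: "distributed N lborel Z1 std_normal_density"
      and Z2: "distributed N lborel Z2 std_normal_density"
      and indep: "prob_space.indep_var N borel Z1 borel Z2"
    then have "0 < l * m" using detS by (simp add: lm)
    interpret N: prob_space N by (rule N)
    let ?h = "\<lambda>(x, y). x\<^sup>2 + 4 * det (A ** S) / (trace (A ** S))\<^sup>2 * y\<^sup>2"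
    have [measurable]: "Z1 \<in> borel_measurable N" "Z2 \<in> borel_measurable N"
      using Z1 Z2 by (auto dest: distributed_measurable)
    have "distr N borel Z1 = gauss" "distr N borel Z2 = gauss"
      using Z1 Z2 by (auto simp: gauss_def distributed_def cong: distr_cong)
    then have joint: "distr N (borel \<Otimes>\<^sub>M borel) (\<lambda>\<omega>. (Z1 \<omega>, Z2 \<omega>)) = gauss \<Otimes>\<^sub>M gauss"
      using indep by (simp add: N.indep_var_distribution_eq)
    have "distr M borel (\<lambda>\<omega>. W f S (X \<omega>)) = distr (distr M borel (\<lambda>\<omega>. 4 * W f S (X \<omega>))) borel (\<lambda>w. 1 / 4 * w)"
      by (subst distr_distr) (auto simp: comp_def)
    also have "\<dots> = distr (distr (gauss \<Otimes>\<^sub>M gauss) borel ?h) borel (\<lambda>w. 1 / 4 * w)"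
      unfolding law distr_gauss_pair_definite[OF \<open>0 < l * m\<close>] det trace ..
    also have "\<dots> = distr N borel (\<lambda>\<omega>. 1 / 4 * ((Z1 \<omega>)\<^sup>2 +
        4 * det (A ** S) / (trace (A ** S))\<^sup>2 * (Z2 \<omega>)\<^sup>2))"
      unfolding joint [symmetric] by (simp add: distr_distr comp_def)
    finally show "distr M borel (\<lambda>\<omega>. W f S (X \<omega>)) = distr N borel (\<lambda>\<omega>. 1 / 4 * ((Z1 \<omega>)\<^sup>2 +
        4 * det (A ** S) / (trace (A ** S))\<^sup>2 * (Z2 \<omega>)\<^sup>2))" .
  qed
qed

end
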